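(* Let $T>0$, $L>0$, $g\in\mathbf R_T^L$, and $G=\Phi g$. Then $G$ can be extended to an entire function $G_e$ of order $\le1$ and type $\le T$, and $$|G_e(z)|\le\frac L\pi\,\frac{e^{T|z|}-1}{|z|},\quad z\in\mathbb C.$$
   Context: $\mathbb R_+=(0,+\infty)$. $\mathbf R_T^L$ is the set of all functions $Y\in L^2(\mathbb R_+)$ for which there is $u\in L^\infty(0,T)$ with $\|u\|_{L^\infty(0,T)}\le L$ such that $Y(r)=-\frac1\pi\int_0^T\frac1{2\xi}e^{-\frac r{4\xi}}u(T-\xi)\,d\xi$, $r\in\mathbb R_+$. The operator $\Phi:L^2(\mathbb R_+)\to L^2(\mathbb R_+)$ is $\Phi=\Psi\mathscr F\Psi^{-1}$, where $(\Psi^{-1}g)(x)=g(|x|^2)$, $x\in\mathbb R^2$, maps $L^2(\mathbb R_+)$ onto the space $\mathcal H$ of radial functions in $L^2(\mathbb R^2)$, $\Psi$ is its inverse, and $\mathscr F$ is the unitary Fourier transform $(\mathscr Ff)(\sigma)=\frac1{2\pi}\iint f(x)e^{-i\langle x,\sigma\rangle}dx$ on $L^2(\mathbb R^2)$. Equivalently, $(\Phi g)(\rho)=\frac12\lim_{N\to\infty}\int_0^Ng(r)J_0(\sqrt{r\rho})\,dr$ (limit in $L^2(\mathbb R_+)$), $J_0$ being the Bessel function of order $0$. An entire function $E$ on $\mathbb C$ is of order $\le1$ and type $\le T$ if for every $\varepsilon>0$ there is $C_\varepsilon$ with $|E(z)|\le C_\varepsilon e^{(T+\varepsilon)|z|}$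 for all $z\in\mathbb C$. "Extended" means agreement a.e. on $\mathbb R_+$. At $z=0$ the quotient $\frac{e^{T|z|}-1}{|z|}$ is understood as its limit $T$. *)

theory Defs
  imports
    "HOL-Complex_Analysis.Complex_Analysis"
    "HOL-Probability.Essential_Supremum"
begin

text \<open>
  Elements of Lebesgue spaces are represented by functions; equality of elements is equality
  almost everywhere. Functions are complex-valued. A function on $(0,\infty)$ or on $(0,T)$ is a
  function on the reals whose values outside that interval are irrelevant.
\<close>

abbreviation lebesgue_pos :: "real measure"
  where "lebesgue_pos \<equiv> lebesgue_on {0<..}"

definition L2 :: "'a measure \<Rightarrow> ('a \<Rightarrow> complex) set"
  where "L2 M = {f \<in> borel_measurable M. integrable M (\<lambda>x. (norm (f x))\<^sup>2)}"

text \<open>The square of the norm distance. It is a nonnegative integral, so that it is infinite, and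
  not the default value 0 of the Bochner integral, when the difference is not in the space.\<close>

definition L2_dist_sq :: "'a measure \<Rightarrow> ('a \<Rightarrow> complex) \<Rightarrow> ('a \<Rightarrow> complex) \<Rightarrow> ennreal"
  where "L2_dist_sq M f h = (\<integral>\<^sup>+x. ennreal ((norm (f x - h x))\<^sup>2) \<partial>M)"

definition Linf_norm :: "'a measure \<Rightarrow> ('a \<Rightarrow> complex) \<Rightarrow> ereal"
  where "Linf_norm M u = esssup M (\<lambda>x. ereal (norm (u x)))"

definition Linf :: "'a measure \<Rightarrow> ('a \<Rightarrow> complex) set"
  where "Linf M = {u \<in> borel_measurable M. Linf_norm M u < \<infinity>}"

definition reachable_set :: "real \<Rightarrow> real \<Rightarrow> (real \<Rightarrow> complex) set"
  where "reachable_set T L =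
    {Y \<in> L2 lebesgue_pos.
      \<exists>u \<in> Linf (lebesgue_on {0<..<T}).
        Linf_norm (lebesgue_on {0<..<T}) u \<le> ereal L \<and>
        (AE r in lebesgue_pos.
          Y r = - (1 / of_real pi) *
            (\<integral>\<xi>. of_real (1 / (2 * \<xi>) * exp (- r / (4 * \<xi>))) * u (T - \<xi>)
               \<partial>lebesgue_on {0<..<T}))}"

definition fourier_integral :: "(real \<times> real \<Rightarrow> complex) \<Rightarrow> real \<times> real \<Rightarrow> complex"
  where "fourier_integral f \<sigma> =
    1 / (2 * of_real pi) * (\<integral>x. f x * exp (- \<i> * of_real (x \<bullet> \<sigma>)) \<partial>lebesgue)"

text \<open>The unitary Fourier transform on the square-integrable functions of the plane. The integral
  need not converge absolutely; it is the limit in the mean of the integrals over growing discs.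
  The limit is unique up to a null set.\<close>

definition fourier_L2 :: "(real \<times> real \<Rightarrow> complex) \<Rightarrow> real \<times> real \<Rightarrow> complex"
  where "fourier_L2 f =
    (SOME h. h \<in> L2 lebesgue \<and>
      ((\<lambda>N::real. L2_dist_sq lebesgue
          (fourier_integral (\<lambda>x. if x \<in> ball 0 N then f x else 0)) h) \<longlongrightarrow> 0) at_top)"

definition Psi_inv :: "(real \<Rightarrow> complex) \<Rightarrow> real \<times> real \<Rightarrow> complex"
  where "Psi_inv g x = g ((norm x)\<^sup>2)"

text \<open>The inverse of \<open>Psi_inv\<close>, up to null sets; unspecified unless \<open>h\<close> agrees almost everywhere
  with a square-integrable radial function.\<close>

definition Psi :: "(real \<times> real \<Rightarrow> complex) \<Rightarrow> real \<Rightarrow> complex"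
  where "Psi h = (SOME g. g \<in> L2 lebesgue_pos \<and> (AE x in lebesgue. Psi_inv g x = h x))"

definition Phi :: "(real \<Rightarrow> complex) \<Rightarrow> real \<Rightarrow> complex"
  where "Phi g = Psi (fourier_L2 (Psi_inv g))"

definition order_le_1_type_le :: "(complex \<Rightarrow> complex) \<Rightarrow> real \<Rightarrow> bool"
  where "order_le_1_type_le E T \<longleftrightarrow>
    (\<forall>\<epsilon>>0. \<exists>C::real. \<forall>z. norm (E z) \<le> C * exp ((T + \<epsilon>) * norm z))"

end

theory Submission
  imports Defs "HOL-Probability.Characteristic_Functions"
begin

text \<open>
  The transform of the heat kernel $\frac1{2\xi}e^{-|x|^2/(4\xi)}$ is $e^{-\xi|\sigma|^2}$, so
  $G_e(z)=-\frac1\pi\int_0^Te^{-\xi z}u(T-\xi)\,d\xi$, for which all the claims are immediate.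
  Since the kernel has $L^1(\mathbb R^2)$ norm $2\pi$ for every $\xi$, the function
  $\Psi^{-1}g$ is integrable and its transform can be computed by Fubini's theorem. That
  this transform is the limit in the mean of the truncated integrals follows from the inequality
  $\|\mathscr Ff\|_2\le\|f\|_2$ for integrable $f$, applied to the tails of $\Psi^{-1}g$.
\<close>

text \<open>\<open>Phi\<close> contains two choices, one in \<open>fourier_L2\<close> and one in
  \<open>Psi\<close>, so that a formula for the transform is usable only after an existence and a
  uniqueness argument for each. For \<open>fourier_L2\<close> uniqueness is that of limits in the
  mean. For \<open>Psi\<close> it is that of a radial profile: the image of planar Lebesgue measure
  under the squared norm is \<open>pi\<close> times Lebesgue measure on the positive half-line, so
  null sets correspond in both directions. A second obstacle is that the spaces live over completed
  measures, whereas Fubini's theorem is applied over \<open>lborel\<close>. Functions are therefore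
  replaced by Borel representatives, and the results are carried back through null sets. The planar
  Gaussian formula serves twice: with parameter \<open>1 / (4 * \<xi>)\<close> it transforms the
  heat kernel, and with a parameter tending to 0 it damps the squared transform in the proof of the
  mean-square inequality.\<close>

section \<open>Gaussian integrals on the line and in the plane\<close>

text \<open>After rescaling this is the characteristic function of the standard normal distribution.
  The Gaussian has variance \<open>1 / (2 * a)\<close>, hence the choice of \<open>c\<close>, and
  the sign in \<open>t\<close> turns \<open>iexp\<close> into the kernel with
  \<open>- \<i>\<close>.\<close>

lemma gaussian_fourier_real:
  fixes a s :: real
  assumes "a > 0"
  shows "has_bochner_integral lborel
    (\<lambda>x. of_real (exp (- (a * x\<^sup>2))) * exp (- \<i> * of_real (x * s)))
    (complex_of_real (sqrt (pi / a) * exp (- (s\<^sup>2 / (4 * a)))))"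
proof -
  define c where "c = sqrt (2 * a)"
  have c: "c > 0" "c\<^sup>2 = 2 * a"
    using assms by (auto simp: c_def)
  define t where "t = - s / c"
  let ?F = "\<lambda>x. std_normal_density x *\<^sub>R iexp (t * x)"
  have int: "integrable lborel ?F"
    by (rule Bochner_Integration.integrable_bound[OF integrable_normal_moment[of 1 0 0]]) 
       (auto simp: norm_mult normal_density_nonneg)
  have "(LINT x|lborel. ?F x) = char std_normal_distribution t"
    unfolding char_def by (subst integral_density) (auto simp: normal_density_nonneg)
  also have "\<dots> = of_real (exp (- (t\<^sup>2) / 2))"
    by (simp add: char_std_normal_distribution)
  finally have "has_bochner_integral lborel ?F (of_real (exp (- (t\<^sup>2) / 2)))"
    using int by (simp add: has_bochner_integral_iff)
  then have "has_bochner_integral lborel (\<lambda>x. ?F (0 + c * x))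
      (of_real (exp (- (t\<^sup>2) / 2)) /\<^sub>R \<bar>c\<bar>)"
    using c by (subst lborel_has_bochner_integral_real_affine_iff[symmetric]) auto
  then have *: "has_bochner_integral lborel (\<lambda>x. sqrt (2 * pi) *\<^sub>R ?F (0 + c * x))
      (sqrt (2 * pi) *\<^sub>R (of_real (exp (- (t\<^sup>2) / 2)) /\<^sub>R \<bar>c\<bar>))"
    by (rule has_bochner_integral_scaleR_right)
  have 1: "sqrt (2 * pi) *\<^sub>R ?F (0 + c * x) = of_real (exp (- (a * x\<^sup>2))) * exp (- \<i> * of_real (x * s))" for x
    using c by (simp add: std_normal_density_def t_def power_mult_distrib scaleR_conv_of_real mult_ac)
  have 2: "sqrt (2 * pi) *\<^sub>R (complex_of_real (exp (- (t\<^sup>2) / 2)) /\<^sub>R \<bar>c\<bar>) =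
     of_real (sqrt (pi / a) * exp (- (s\<^sup>2 / (4 * a))))"
  proof -
    have q: "sqrt (2 * pi) / c = sqrt (pi / a)"
      using assms by (simp add: c_def real_sqrt_divide real_sqrt_mult)
    have t: "- (t\<^sup>2) / 2 = - (s\<^sup>2 / (4 * a))"
      using c assms by (simp add: t_def power_divide)
    have "sqrt (2 * pi) * (inverse \<bar>c\<bar> * exp (- (t\<^sup>2) / 2)) =
        sqrt (2 * pi) / c * exp (- (t\<^sup>2) / 2)"
      using c by (simp only: divide_inverse abs_of_pos mult.assoc)
    also have "\<dots> = sqrt (pi / a) * exp (- (s\<^sup>2 / (4 * a)))"
      by (simp only: q t)
    finally show ?thesis
      by (simp only: scaleR_conv_of_real of_real_mult[symmetric])
  qed
  show ?thesis
    using * unfolding 1 2 .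
qed

lemma has_bochner_integral_lborel_times:
  fixes f :: "'a::euclidean_space \<Rightarrow> complex" and h :: "'b::euclidean_space \<Rightarrow> complex"
  assumes "has_bochner_integral lborel f a" "has_bochner_integral lborel h b"
  shows "has_bochner_integral lborel (\<lambda>x. f (fst x) * h (snd x)) (a * b)"
proof -
  have f: "integrable lborel f" "integral\<^sup>L lborel f = a"
    and h: "integrable lborel h" "integral\<^sup>L lborel h = b"
    using assms by (auto simp: has_bochner_integral_iff)
  have [measurable]: "f \<in> borel_measurable borel" "h \<in> borel_measurable borel"
    using f h by (auto dest: borel_measurable_integrable)
  have "integrable (lborel \<Otimes>\<^sub>M lborel) (\<lambda>x. f (fst x) * h (snd x))"
    using f h by (intro lborel_pair.Fubini_integrable) (auto simp: norm_mult)
  moreover from lborel_pair.integral_fst'[OF this]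
  have "integral\<^sup>L (lborel \<Otimes>\<^sub>M lborel) (\<lambda>x. f (fst x) * h (snd x)) = a * b"
    using f h by simp
  ultimately show ?thesis
    by (simp add: has_bochner_integral_iff lborel_prod)
qed

text \<open>Both the Gaussian and the character are products over the two coordinates, so the square
  roots of \<open>pi / a\<close> multiply to \<open>pi / a\<close>.\<close>

lemma gaussian_fourier_plane:
  fixes a :: real and s :: "real \<times> real"
  assumes "a > 0"
  shows "has_bochner_integral lborel
    (\<lambda>x. of_real (exp (- (a * (norm x)\<^sup>2))) * exp (- \<i> * of_real (x \<bullet> s)))
    (complex_of_real (pi / a * exp (- ((norm s)\<^sup>2 / (4 * a)))))"
proof -
  have 1: "complex_of_real (exp (- (a * (fst x)\<^sup>2))) * exp (- \<i> * of_real (fst x * fst s)) *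
      (of_real (exp (- (a * (snd x)\<^sup>2))) * exp (- \<i> * of_real (snd x * snd s))) =
      of_real (exp (- (a * (norm x)\<^sup>2))) * exp (- \<i> * of_real (x \<bullet> s))" for x
    by (simp add: norm_prod_def inner_prod_def of_real_exp exp_minus exp_add algebra_simps
        flip: exp_add exp_minus)
  have 2: "complex_of_real (sqrt (pi / a) * exp (- ((fst s)\<^sup>2 / (4 * a)))) *
      of_real (sqrt (pi / a) * exp (- ((snd s)\<^sup>2 / (4 * a)))) =
      of_real (pi / a * exp (- ((norm s)\<^sup>2 / (4 * a))))"
  proof -
    have "sqrt (pi / a) * sqrt (pi / a) = pi / a"
      using assms by simp
    moreover have "exp (- ((norm s)\<^sup>2 / (4 * a))) = 
        exp (- ((fst s)\<^sup>2 / (4 * a))) * exp (- ((snd s)\<^sup>2 / (4 * a)))"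
      by (simp add: norm_prod_def add_divide_distrib exp_add[symmetric])
    ultimately show ?thesis
      by (metis (no_types, opaque_lifting) mult.assoc mult.left_commute of_real_mult)
  qed
  show ?thesis
    using has_bochner_integral_lborel_times[OF gaussian_fourier_real[OF assms, of "fst s"]
        gaussian_fourier_real[OF assms, of "snd s"]]
    unfolding 1 2 .
qed

lemma gaussian_integral_plane:
  assumes "a > 0"
  shows "has_bochner_integral lborel (\<lambda>x::real \<times> real. exp (- (a * (norm x)\<^sup>2))) (pi / a)"
  using has_bochner_integral_Re[OF gaussian_fourier_plane[OF assms, of 0]] by simp

lemma nn_integral_gaussian_plane:
  assumes "a > 0"
  shows "(\<integral>\<^sup>+x. ennreal (exp (- (a * (norm (x - y))\<^sup>2))) \<partial>(lborel :: (real \<times> real) measure))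
    = ennreal (pi / a)"
proof -
  let ?f = "\<lambda>x :: real \<times> real. ennreal (exp (- (a * (norm x)\<^sup>2)))"
  have "(\<integral>\<^sup>+x. ?f (x - y) \<partial>lborel) = (\<integral>\<^sup>+x. ?f x \<partial>distr lborel borel (\<lambda>x. - y + x))"
    by (subst nn_integral_distr) auto
  also have "\<dots> = ennreal (pi / a)"
    using gaussian_integral_plane[OF assms]
    by (subst lborel_distr_plus) (simp add: has_bochner_integral_iff nn_integral_eq_integral)
  finally show ?thesis .
qed

section \<open>Planar Lebesgue measure in the variable |x|^2\<close>

text \<open>In the variable r = |x|^2 the area element 2 pi \<rho> d\<rho> of polar coordinates is
  pi dr. The half-lines up to \<open>a\<close> generate the Borel sets and their preimages are discs
  of area \<open>pi * a\<close>, so comparing areas of discs suffices.\<close>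

lemma distr_norm_square_plane:
  "distr lborel borel (\<lambda>x::real \<times> real. (norm x)\<^sup>2) =
   density lborel (\<lambda>r. ennreal pi * indicator {0<..} r)" (is "?M = ?N")
proof (rule measure_eqI_generator_eq)
  let ?E = "range (\<lambda>a::real. {..a})"
  show "Int_stable ?E"
    by (auto simp: Int_stable_def)
  have eq: "emeasure ?M {..a} = ennreal (pi * a)" "emeasure ?N {..a} = ennreal (pi * a)" for a
  proof -
    have "emeasure ?M {..a} = emeasure lborel ((\<lambda>x::real \<times> real. (norm x)\<^sup>2) -` {..a})"
      by (subst emeasure_distr) auto
    \<comment> \<open>The real \<open>sqrt\<close> is odd: a negative \<open>a\<close> gives a
      negative radius and an empty disc, matching the empty preimage, and \<open>ennreal\<close>
      sends the negative \<open>pi * a\<close> to 0.\<close>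
    also have "(\<lambda>x::real \<times> real. (norm x)\<^sup>2) -` {..a} = cball 0 (sqrt a)"
    proof (intro set_eqI)
      fix x :: "real \<times> real"
      show "x \<in> (\<lambda>x. (norm x)\<^sup>2) -` {..a} \<longleftrightarrow> x \<in> cball 0 (sqrt a)"
        using real_sqrt_le_iff[of "(norm x)\<^sup>2" a] by simp
    qed
    also have "emeasure lborel \<dots> = ennreal (pi * a)"
    proof (cases "0 \<le> a")
      case True
      then show ?thesis
        by (subst emeasure_cball) (simp_all add: unit_ball_vol_numeral)
    next
      case False
      then show ?thesis
        by (simp add: ennreal_neg mult_nonneg_nonpos)
    qed
    finally show "emeasure ?M {..a} = ennreal (pi * a)" .
    have "emeasure ?N {..a} = (\<integral>\<^sup>+ r. ennreal pi * indicator {0<..a} r \<partial>lborel)"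
      by (subst emeasure_density) (auto intro!: nn_integral_cong split: split_indicator)
    also have "\<dots> = ennreal (pi * a)"
      by (cases "0 \<le> a") (auto simp: nn_integral_cmult_indicator ennreal_mult ennreal_neg mult_nonneg_nonpos)
    finally show "emeasure ?N {..a} = ennreal (pi * a)" .
  qed
  show "emeasure ?M X = emeasure ?N X" if "X \<in> ?E" for X
    using that eq by auto
  show "range (\<lambda>n. {..real n}) \<subseteq> ?E" "(\<Union>n. {..real n}) = UNIV"
    by (auto intro: real_arch_simple)
  show "emeasure ?M {..real n} \<noteq> \<infinity>" for n
    by (simp add: eq)
  show "sets ?M = sigma_sets UNIV ?E" "sets ?N = sigma_sets UNIV ?E"
    by (simp_all add: borel_eq_atMost)
qed simp

section \<open>The Fourier integral of an integrable function and its mean-square bound\<close>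

lemma borel_measurable_fst_snd [measurable (raw)]:
  fixes f :: "'c \<Rightarrow> 'a::second_countable_topology \<times> 'b::second_countable_topology"
  assumes "f \<in> borel_measurable M"
  shows "(\<lambda>x. fst (f x)) \<in> borel_measurable M" "(\<lambda>x. snd (f x)) \<in> borel_measurable M"
  using assms by (simp_all add: borel_prod[symmetric])

lemma nn_integral_lborel_pair:
  fixes f :: "'a::euclidean_space \<times> 'b::euclidean_space \<Rightarrow> ennreal"
  assumes "f \<in> borel_measurable borel"
  shows "(\<integral>\<^sup>+x. f x \<partial>lborel) = (\<integral>\<^sup>+x. \<integral>\<^sup>+y. f (x, y) \<partial>lborel \<partial>lborel)"
    and "(\<integral>\<^sup>+x. f x \<partial>lborel) = (\<integral>\<^sup>+y. \<integral>\<^sup>+x. f (x, y) \<partial>lborel \<partial>lborel)"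
proof -
  have f: "f \<in> borel_measurable (lborel \<Otimes>\<^sub>M lborel)"
    using assms by (simp add: lborel_prod)
  show "(\<integral>\<^sup>+x. f x \<partial>lborel) = (\<integral>\<^sup>+x. \<integral>\<^sup>+y. f (x, y) \<partial>lborel \<partial>lborel)"
    using lborel.nn_integral_fst[OF f] by (simp add: lborel_prod)
  show "(\<integral>\<^sup>+x. f x \<partial>lborel) = (\<integral>\<^sup>+y. \<integral>\<^sup>+x. f (x, y) \<partial>lborel \<partial>lborel)"
    using lborel_pair.nn_integral_snd[OF f] by (simp add: lborel_prod)
qed

lemma fourier_integral_borel:
  assumes [measurable]: "f \<in> borel_measurable borel"
  shows "fourier_integral f \<sigma> =
    1 / (2 * of_real pi) * (\<integral>x. f x * exp (- \<i> * of_real (x \<bullet> \<sigma>)) \<partial>lborel)"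
  unfolding fourier_integral_def by (subst integral_completion) auto

lemma borel_measurable_fourier_integral:
  assumes [measurable]: "f \<in> borel_measurable borel"
  shows "fourier_integral f \<in> borel_measurable borel"
proof -
  have "(\<lambda>\<sigma>. 1 / (2 * of_real pi) * (\<integral>x. f x * exp (- \<i> * of_real (x \<bullet> \<sigma>)) \<partial>lborel))
      \<in> borel_measurable borel"
    by measurable
  then show ?thesis
    by (subst fourier_integral_borel[OF assms, abs_def])
qed

text \<open>The squared modulus is \<open>I * cnj I\<close>, an integral over pairs of points. In
  this form \<sigma> occurs in a single exponential and can be integrated out. The factor
  \<open>4 * pi\<^sup>2\<close> is the squared normalisation of the transform.\<close>

lemma fourier_integral_norm_square:
  assumes "integrable lborel f"
  shows "has_bochner_integral lborel
    (\<lambda>x. f (fst x) * cnj (f (snd x)) * exp (- \<i> * of_real ((fst x - snd x) \<bullet> \<sigma>)))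
    (of_real (4 * pi\<^sup>2 * (norm (fourier_integral f \<sigma>))\<^sup>2))"
proof -
  have [measurable]: "f \<in> borel_measurable borel"
    using assms by (auto dest: borel_measurable_integrable)
  define I where "I = (\<integral>x. f x * exp (- \<i> * of_real (x \<bullet> \<sigma>)) \<partial>lborel)"
  have "integrable lborel (\<lambda>x. f x * exp (- \<i> * of_real (x \<bullet> \<sigma>)))"
    by (rule Bochner_Integration.integrable_bound[OF assms]) (auto simp: norm_mult)
  then have I: "has_bochner_integral lborel (\<lambda>x. f x * exp (- \<i> * of_real (x \<bullet> \<sigma>))) I"
    by (simp add: I_def has_bochner_integral_iff)
  then have "has_bochner_integral lborel (\<lambda>x. cnj (f x * exp (- \<i> * of_real (x \<bullet> \<sigma>)))) (cnj I)"
    by (rule has_bochner_integral_bounded_linear[OF bounded_linear_cnj])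
  from has_bochner_integral_lborel_times[OF I this]
  have "has_bochner_integral lborel
    (\<lambda>x. f (fst x) * cnj (f (snd x)) * exp (- \<i> * of_real ((fst x - snd x) \<bullet> \<sigma>))) (I * cnj I)"
    by (simp add: exp_cnj inner_diff_left exp_diff exp_minus field_simps)
  moreover have "I = 2 * of_real pi * fourier_integral f \<sigma>"
    by (simp add: fourier_integral_borel I_def)
  then have "I * cnj I = of_real (4 * pi\<^sup>2 * (norm (fourier_integral f \<sigma>))\<^sup>2)"
    by (simp only: complex_norm_square[symmetric]) (simp add: norm_mult power_mult_distrib)
  ultimately show ?thesis
    by simp
qed

text \<open>A Schur test: once the product is bounded by the mean of the squares, each half contains
  \<open>f\<close> at one point only, and the Gaussian integrates over the other point to
  \<open>pi / a\<close> wherever it is centred.\<close>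

lemma nn_integral_product_gaussian_le:
  fixes f :: "real \<times> real \<Rightarrow> complex"
  assumes [measurable]: "f \<in> borel_measurable borel" and "a > 0"
  shows "(\<integral>\<^sup>+x. ennreal (norm (f (fst x)) * norm (f (snd x)) *
      exp (- (a * (norm (fst x - snd x))\<^sup>2))) \<partial>lborel) \<le>
    ennreal (pi / a) * (\<integral>\<^sup>+x. ennreal ((norm (f x))\<^sup>2) \<partial>lborel)"
proof -
  let ?g = "\<lambda>x y :: real \<times> real. ennreal (exp (- (a * (norm (x - y))\<^sup>2)))"
  let ?h = "\<lambda>x. ennreal ((norm (f x))\<^sup>2 / 2)"
  have "(\<integral>\<^sup>+x. ennreal (norm (f (fst x)) * norm (f (snd x)) *
      exp (- (a * (norm (fst x - snd x))\<^sup>2))) \<partial>lborel) \<le>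
    (\<integral>\<^sup>+x. ?h (fst x) * ?g (snd x) (fst x) + ?h (snd x) * ?g (fst x) (snd x) \<partial>lborel)"
  proof (rule nn_integral_mono)
    fix x :: "(real \<times> real) \<times> (real \<times> real)"
    have "norm (f (fst x)) * norm (f (snd x)) \<le> (norm (f (fst x)))\<^sup>2 / 2 + (norm (f (snd x)))\<^sup>2 / 2"
      using sum_squares_bound[of "norm (f (fst x))" "norm (f (snd x))"] by simp
    then have "norm (f (fst x)) * norm (f (snd x)) * exp (- (a * (norm (fst x - snd x))\<^sup>2)) \<le>
       ((norm (f (fst x)))\<^sup>2 / 2 + (norm (f (snd x)))\<^sup>2 / 2) * exp (- (a * (norm (fst x - snd x))\<^sup>2))"
      by (rule mult_right_mono) simp
    then show "ennreal (norm (f (fst x)) * norm (f (snd x)) * exp (- (a * (norm (fst x - snd x))\<^sup>2))) \<le>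
       ?h (fst x) * ?g (snd x) (fst x) + ?h (snd x) * ?g (fst x) (snd x)"
      by (simp add: norm_minus_commute distrib_right ennreal_leI
          flip: ennreal_mult ennreal_plus)
  qed
  also have "\<dots> = (\<integral>\<^sup>+x. ?h (fst x) * ?g (snd x) (fst x) \<partial>lborel) +
      (\<integral>\<^sup>+x. ?h (snd x) * ?g (fst x) (snd x) \<partial>lborel)"
    by (rule nn_integral_add) measurable
  also have "(\<integral>\<^sup>+x. ?h (fst x) * ?g (snd x) (fst x) \<partial>lborel) =
      (\<integral>\<^sup>+x. \<integral>\<^sup>+y. ?h x * ?g y x \<partial>lborel \<partial>lborel)"
    by (subst nn_integral_lborel_pair(1)) auto
  also have "(\<integral>\<^sup>+x. ?h (snd x) * ?g (fst x) (snd x) \<partial>lborel) =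
      (\<integral>\<^sup>+y. \<integral>\<^sup>+x. ?h y * ?g x y \<partial>lborel \<partial>lborel)"
    by (subst nn_integral_lborel_pair(2)) auto
  \<comment> \<open>The orders of integration were chosen so that the two iterated integrals differ
    only in bound names; this equation therefore rewrites both summands.\<close>
  also have "(\<integral>\<^sup>+y. \<integral>\<^sup>+x. ?h y * ?g x y \<partial>lborel \<partial>lborel) =
      ennreal (pi / a) * (\<integral>\<^sup>+x. ?h x \<partial>lborel)"
    using \<open>a > 0\<close> by (simp add: nn_integral_cmult nn_integral_gaussian_plane nn_integral_multc mult.commute)
  also have "\<dots> + \<dots> = ennreal (pi / a) * (\<integral>\<^sup>+x. ?h x + ?h x \<partial>lborel)"
    by (subst nn_integral_add) (auto simp: distrib_left)
  also have "(\<integral>\<^sup>+x. ?h x + ?h x \<partial>lborel) = (\<integral>\<^sup>+x. ennreal ((norm (f x))\<^sup>2) \<partial>lborel)"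
    by (intro nn_integral_cong) (simp flip: ennreal_plus)
  finally show ?thesis .
qed

text \<open>
  The Gaussian factor makes the triple integral over $x$, $y$ and $\sigma$ absolutely convergent.
  Integrating over $\sigma$ first leaves $f(x)\overline{f(y)}$ against a Gaussian in $x-y$, and
  $2|f(x)f(y)|\le|f(x)|^2+|f(y)|^2$ bounds the rest.
\<close>

lemma fourier_integral_gaussian_mean_le:
  assumes f: "integrable lborel f" and "\<epsilon> > 0"
  shows "(\<integral>\<^sup>+\<sigma>. ennreal ((norm (fourier_integral f \<sigma>))\<^sup>2 * exp (- (\<epsilon> * (norm \<sigma>)\<^sup>2))) \<partial>lborel)
    \<le> (\<integral>\<^sup>+x. ennreal ((norm (f x))\<^sup>2) \<partial>lborel)"
proof -
  have [measurable]: "f \<in> borel_measurable borel"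
    using f by (auto dest: borel_measurable_integrable)
  note [measurable] = borel_measurable_fourier_integral[of f]
  define H where "H = (\<lambda>(x, \<sigma>). f (fst x) * cnj (f (snd x)) *
    exp (- \<i> * of_real ((fst x - snd x) \<bullet> \<sigma>)) * of_real (exp (- (\<epsilon> * (norm \<sigma>)\<^sup>2))))"
  have [measurable]: "cnj \<in> borel_measurable borel"
    by (intro borel_measurable_continuous_onI continuous_intros)
  have "H \<in> borel_measurable ((borel \<Otimes>\<^sub>M borel) \<Otimes>\<^sub>M borel)"
    unfolding H_def case_prod_beta by measurable
  then have [measurable]: "H \<in> borel_measurable borel"
    by (simp only: borel_prod)
  have ff: "integrable lborel (\<lambda>x. f (fst x) * cnj (f (snd x)))"
    using has_bochner_integral_lborel_times[of f _ "\<lambda>x. cnj (f x)"] f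
    by (auto simp: has_bochner_integral_iff)
  have "integrable lborel (\<lambda>\<sigma>::real\<times>real. complex_of_real (exp (- (\<epsilon> * (norm \<sigma>)\<^sup>2))))"
    using gaussian_fourier_plane[OF \<open>\<epsilon> > 0\<close>, of 0] by (auto simp: has_bochner_integral_iff)
  with ff have "integrable lborel (\<lambda>x. (f (fst (fst x)) * cnj (f (snd (fst x)))) *
     complex_of_real (exp (- (\<epsilon> * (norm (snd x :: real \<times> real))\<^sup>2))))"
    using has_bochner_integral_lborel_times[of "\<lambda>x. f (fst x) * cnj (f (snd x))" _
        "\<lambda>\<sigma>::real\<times>real. complex_of_real (exp (- (\<epsilon> * (norm \<sigma>)\<^sup>2)))"]
    by (auto simp: has_bochner_integral_iff)
  then have H: "integrable (lborel \<Otimes>\<^sub>M lborel) H"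
    unfolding lborel_prod by (rule Bochner_Integration.integrable_bound) (auto simp: H_def norm_mult)
  have 1: "(\<integral>x. H (x, \<sigma>) \<partial>lborel) =
      of_real (4 * pi\<^sup>2 * (norm (fourier_integral f \<sigma>))\<^sup>2 * exp (- (\<epsilon> * (norm \<sigma>)\<^sup>2)))" for \<sigma>
    using fourier_integral_norm_square[OF f, of \<sigma>] by (simp add: H_def has_bochner_integral_iff)
  have 2: "(\<integral>\<sigma>. H (x, \<sigma>) \<partial>lborel) = f (fst x) * cnj (f (snd x)) *
      of_real (pi / \<epsilon> * exp (- ((norm (fst x - snd x))\<^sup>2 / (4 * \<epsilon>))))" for x
  proof -
    have "(\<integral>\<sigma>. H (x, \<sigma>) \<partial>lborel) = (\<integral>\<sigma>. f (fst x) * cnj (f (snd x)) *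
      (of_real (exp (- (\<epsilon> * (norm \<sigma>)\<^sup>2))) * exp (- \<i> * of_real (\<sigma> \<bullet> (fst x - snd x)))) \<partial>lborel)"
      by (simp add: H_def mult_ac inner_commute)
    also have "\<dots> = f (fst x) * cnj (f (snd x)) *
        of_real (pi / \<epsilon> * exp (- ((norm (fst x - snd x))\<^sup>2 / (4 * \<epsilon>))))"
      using gaussian_fourier_plane[OF \<open>\<epsilon> > 0\<close>, of "fst x - snd x"]
      by (simp only: integral_mult_right_zero has_bochner_integral_iff)
    finally show ?thesis .
  qed
  \<comment> \<open>\<open>pi / \<epsilon>\<close> comes from transforming the damping factor, and
    \<open>4 * pi * \<epsilon>\<close> is the mass of the resulting Gaussian in the difference of
    the two points. Their product is independent of \<epsilon> and equals the squared normalisation,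
    which is why the final inequality has constant 1.\<close>
  have c: "ennreal (pi / \<epsilon>) * ennreal (pi / (1 / (4 * \<epsilon>))) = ennreal (4 * pi\<^sup>2)"
    using \<open>\<epsilon> > 0\<close> by (simp add: power2_eq_square flip: ennreal_mult)
  let ?N = "\<lambda>\<sigma>. (norm (fourier_integral f \<sigma>))\<^sup>2 * exp (- (\<epsilon> * (norm \<sigma>)\<^sup>2))"
  have int: "integrable lborel (\<lambda>\<sigma>. complex_of_real (4 * pi\<^sup>2 * ?N \<sigma>))"
    using lborel_pair.integrable_snd[of "\<lambda>x y. H (x, y)"] H unfolding 1 by (simp add: mult_ac)
  have "(\<integral>\<^sup>+\<sigma>. ennreal (4 * pi\<^sup>2 * ?N \<sigma>) \<partial>lborel) = ennreal (\<integral>\<sigma>. 4 * pi\<^sup>2 * ?N \<sigma> \<partial>lborel)"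
    using int unfolding complex_of_real_integrable_eq by (intro nn_integral_eq_integral) auto
  \<comment> \<open>The integrand is nonnegative, so passing to the modulus of a complex integral
    loses nothing; the estimate is made only after the order of integration of \<open>H\<close> has
    been exchanged.\<close>
  also have "(\<integral>\<sigma>. 4 * pi\<^sup>2 * ?N \<sigma> \<partial>lborel) = norm (\<integral>\<sigma>. complex_of_real (4 * pi\<^sup>2 * ?N \<sigma>) \<partial>lborel)"
    unfolding integral_complex_of_real by (simp add: integral_nonneg_AE norm_mult norm_power)
  also have "(\<integral>\<sigma>. complex_of_real (4 * pi\<^sup>2 * ?N \<sigma>) \<partial>lborel) = (\<integral>\<sigma>. (\<integral>x. H (x, \<sigma>) \<partial>lborel) \<partial>lborel)"
    unfolding 1 by (simp add: mult_ac)
  also have "\<dots> = (\<integral>x. (\<integral>\<sigma>. H (x, \<sigma>) \<partial>lborel) \<partial>lborel)"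
    using H by (intro lborel_pair.Fubini_integral) simp
  also have "ennreal (norm \<dots>) \<le> (\<integral>\<^sup>+x. ennreal (norm (\<integral>\<sigma>. H (x, \<sigma>) \<partial>lborel)) \<partial>lborel)"
    using lborel_pair.integrable_fst'[OF H] by (rule integral_norm_bound_ennreal)
  also have "\<dots> = (\<integral>\<^sup>+x. ennreal (pi / \<epsilon>) * ennreal (norm (f (fst x)) * norm (f (snd x)) *
      exp (- (1 / (4 * \<epsilon>) * (norm (fst x - snd x))\<^sup>2))) \<partial>lborel)"
    unfolding 2 using \<open>\<epsilon> > 0\<close>
    by (intro nn_integral_cong) (simp add: norm_mult norm_divide mult_ac abs_mult flip: ennreal_mult)
  also have "\<dots> = ennreal (pi / \<epsilon>) * (\<integral>\<^sup>+x. ennreal (norm (f (fst x)) * norm (f (snd x)) *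
      exp (- (1 / (4 * \<epsilon>) * (norm (fst x - snd x))\<^sup>2))) \<partial>lborel)"
    by (rule nn_integral_cmult) measurable
  also have "\<dots> \<le> ennreal (pi / \<epsilon>) * (ennreal (pi / (1 / (4 * \<epsilon>))) *
      (\<integral>\<^sup>+x. ennreal ((norm (f x))\<^sup>2) \<partial>lborel))"
    using \<open>\<epsilon> > 0\<close> by (intro mult_left_mono nn_integral_product_gaussian_le) auto
  also have "\<dots> = ennreal (4 * pi\<^sup>2) * (\<integral>\<^sup>+x. ennreal ((norm (f x))\<^sup>2) \<partial>lborel)"
    unfolding mult.assoc[symmetric] c ..
  also have "(\<integral>\<^sup>+\<sigma>. ennreal (4 * pi\<^sup>2 * ?N \<sigma>) \<partial>lborel) = ennreal (4 * pi\<^sup>2) * (\<integral>\<^sup>+\<sigma>. ennreal (?N \<sigma>) \<partial>lborel)"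
    by (subst nn_integral_cmult[symmetric]) (auto intro!: nn_integral_cong simp flip: ennreal_mult)
  finally show ?thesis
    by (subst (asm) ennreal_mult_le_mult_iff) auto
qed

text \<open>Fatou's lemma with damping \<open>1 / real (Suc n)\<close>: the damped integrals have a
  bound independent of the parameter, and the damped integrands tend pointwise to the full
  one.\<close>

lemma fourier_integral_L2_le:
  assumes f: "integrable lborel f"
  shows "(\<integral>\<^sup>+\<sigma>. ennreal ((norm (fourier_integral f \<sigma>))\<^sup>2) \<partial>lborel)
    \<le> (\<integral>\<^sup>+x. ennreal ((norm (f x))\<^sup>2) \<partial>lborel)"
proof -
  have [measurable]: "f \<in> borel_measurable borel"
    using f by (auto dest: borel_measurable_integrable)
  note [measurable] = borel_measurable_fourier_integral[of f]
  let ?u = "\<lambda>n \<sigma>. ennreal ((norm (fourier_integral f \<sigma>))\<^sup>2 * exp (- (1 / real (Suc n) * (norm \<sigma>)\<^sup>2)))"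
  have "(\<lambda>n. ?u n \<sigma>) \<longlonglongrightarrow> ennreal ((norm (fourier_integral f \<sigma>))\<^sup>2 * exp (- (0 * (norm \<sigma>)\<^sup>2)))" for \<sigma>
    by (intro tendsto_intros tendsto_ennrealI LIMSEQ_inverse_real_of_nat[unfolded inverse_eq_divide])
  then have "liminf (\<lambda>n. ?u n \<sigma>) = ennreal ((norm (fourier_integral f \<sigma>))\<^sup>2)" for \<sigma>
    by (intro lim_imp_Liminf) auto
  then have "(\<integral>\<^sup>+\<sigma>. ennreal ((norm (fourier_integral f \<sigma>))\<^sup>2) \<partial>lborel) \<le>
      liminf (\<lambda>n. \<integral>\<^sup>+\<sigma>. ?u n \<sigma> \<partial>lborel)"
    using nn_integral_liminf[of ?u lborel] by simp
  also have "\<dots> \<le> limsup (\<lambda>n. \<integral>\<^sup>+\<sigma>. ?u n \<sigma> \<partial>lborel)"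
    by (simp add: Liminf_le_Limsup)
  also have "\<dots> \<le> (\<integral>\<^sup>+x. ennreal ((norm (f x))\<^sup>2) \<partial>lborel)"
    by (intro Limsup_bounded always_eventually allI fourier_integral_gaussian_mean_le[OF f]) simp
  finally show ?thesis .
qed

section \<open>Null sets and Borel representatives for completed measures\<close>

text \<open>Changing values within a null set \<open>Z\<close> alters preimages only within
  \<open>Z\<close>, and every subset of \<open>Z\<close> is measurable in the completion.\<close>

lemma measurable_completion_AE:
  assumes f: "f \<in> measurable M N" and "AE x in M. f x = g x" and g: "g \<in> space M \<rightarrow> space N"
  shows "g \<in> measurable (completion M) N"
proof (rule measurableI)
  fix A assume A: "A \<in> sets N"
  obtain Z where Z: "{x \<in> space M. f x \<noteq> g x} \<subseteq> Z" "Z \<in> null_sets M"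
    using assms(2) unfolding eventually_ae_filter by auto
  have "g -` A \<inter> space M = (f -` A \<inter> space M - Z) \<union> (g -` A \<inter> Z \<inter> space M)"
    using Z(1) by auto
  moreover have "f -` A \<inter> space M - Z \<in> sets (completion M)"
    using Z(2) measurable_sets[OF f A] by auto
  moreover have "g -` A \<inter> Z \<inter> space M \<in> sets (completion M)"
    using Z(2) by (intro null_sets_completion[of Z]) auto
  ultimately show "g -` A \<inter> space (completion M) \<in> sets (completion M)"
    by auto
qed (use g in auto)

text \<open>The bridge from the Lebesgue integrals of the definitions to Borel integrals:
  \<open>g\<close> may be any representative, its measurability being deduced from that of
  \<open>f\<close>.\<close>

lemma integral_completion_AE:
  fixes f g :: "'a \<Rightarrow> 'b::{banach, second_countable_topology}"
  assumes f: "f \<in> borel_measurable M" and eq: "AE x in M. g x = f x"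
  shows "integral\<^sup>L (completion M) g = integral\<^sup>L M f"
proof -
  have "g \<in> borel_measurable (completion M)"
    using eq by (intro measurable_completion_AE[OF f]) auto
  then have "integral\<^sup>L (completion M) g = integral\<^sup>L (completion M) f"
    using f eq by (intro integral_cong_AE) (auto simp: AE_completion_iff measurable_completion)
  then show ?thesis
    by (simp add: integral_completion[OF f])
qed

text \<open>The indicator has a Borel representative \<open>q\<close>, and \<open>q x = 1\<close> is
  then a Borel version of the predicate.\<close>

lemma completion_ex_borel_pred:
  assumes "Measurable.pred (completion M) P"
  shows "\<exists>Q. Measurable.pred M Q \<and> (AE x in M. P x \<longleftrightarrow> Q x)"
proof -
  have "(\<lambda>x. indicat_real (Collect P) x) \<in> borel_measurable (completion M)"
    using assms by measurable
  from completion_ex_borel_measurable_real[OF this]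
  obtain q where [measurable]: "q \<in> borel_measurable M"
    and q: "AE x in M. indicat_real (Collect P) x = q x"
    by auto
  show ?thesis
  proof (intro exI conjI)
    show "Measurable.pred M (\<lambda>x. q x = 1)"
      by measurable
    show "AE x in M. P x \<longleftrightarrow> q x = 1"
      using q by eventually_elim (auto split: split_indicator_asm)
  qed
qed

lemma completion_ex_borel_measurable_complex:
  fixes f :: "'a \<Rightarrow> complex"
  assumes "f \<in> borel_measurable (completion M)"
  shows "\<exists>f'\<in>borel_measurable M. AE x in M. f x = f' x"
proof -
  have "(\<lambda>x. Re (f x)) \<in> borel_measurable (completion M)" "(\<lambda>x. Im (f x)) \<in> borel_measurable (completion M)"
    using assms by auto
  from this[THEN completion_ex_borel_measurable_real]
  obtain a b where ab: "a \<in> borel_measurable M" "b \<in> borel_measurable M"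
    and ae: "AE x in M. Re (f x) = a x" "AE x in M. Im (f x) = b x"
    by auto
  show ?thesis
  proof
    show "(\<lambda>x. Complex (a x) (b x)) \<in> borel_measurable M"
      using ab by (simp add: borel_measurable_complex_iff)
    show "AE x in M. f x = Complex (a x) (b x)"
      using ae by eventually_elim (simp add: complex_eq_iff)
  qed
qed

section \<open>Limits in the mean and the transform of square-integrable functions\<close>

text \<open>For every \<open>N\<close> the distance from \<open>h\<close> to \<open>k\<close> is at
  most twice the sum of two quantities tending to 0, the factor 2 being the price of squaring the
  triangle inequality. This determines the choice in \<open>fourier_L2\<close> up to a null
  set.\<close>

lemma L2_limit_unique:
  fixes F :: "real \<Rightarrow> 'a \<Rightarrow> complex"
  assumes [measurable]: "\<And>N. F N \<in> borel_measurable M" "h \<in> borel_measurable M" "k \<in> borel_measurable M"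
    and h: "((\<lambda>N. L2_dist_sq M (F N) h) \<longlongrightarrow> 0) at_top"
    and k: "((\<lambda>N. L2_dist_sq M (F N) k) \<longlongrightarrow> 0) at_top"
  shows "AE x in M. h x = k x"
proof -
  have le: "L2_dist_sq M h k \<le> 2 * (L2_dist_sq M (F N) h + L2_dist_sq M (F N) k)" for N
  proof -
    have "L2_dist_sq M h k \<le> (\<integral>\<^sup>+x. 2 * (ennreal ((norm (F N x - h x))\<^sup>2) + ennreal ((norm (F N x - k x))\<^sup>2)) \<partial>M)"
      unfolding L2_dist_sq_def
    proof (rule nn_integral_mono)
      fix x
      have "norm (h x - k x) \<le> norm (F N x - h x) + norm (F N x - k x)"
        by (metis dist_norm dist_triangle3 dist_commute norm_minus_commute)
      then have "(norm (h x - k x))\<^sup>2 \<le> (norm (F N x - h x) + norm (F N x - k x))\<^sup>2"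
        by (intro power_mono) auto
      also have "\<dots> \<le> 2 * ((norm (F N x - h x))\<^sup>2 + (norm (F N x - k x))\<^sup>2)"
        using sum_squares_bound[of "norm (F N x - h x)" "norm (F N x - k x)"]
        by (simp add: power2_sum)
      finally have "ennreal ((norm (h x - k x))\<^sup>2) \<le>
          ennreal (2 * ((norm (F N x - h x))\<^sup>2 + (norm (F N x - k x))\<^sup>2))"
        by (rule ennreal_leI)
      then show "ennreal ((norm (h x - k x))\<^sup>2) \<le>
          2 * (ennreal ((norm (F N x - h x))\<^sup>2) + ennreal ((norm (F N x - k x))\<^sup>2))"
        by (simp add: ennreal_mult)
    qed
    also have "\<dots> = 2 * (L2_dist_sq M (F N) h + L2_dist_sq M (F N) k)"
      unfolding L2_dist_sq_def by (simp add: nn_integral_cmult nn_integral_add)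
    finally show ?thesis .
  qed
  have "((\<lambda>N. 2 * (L2_dist_sq M (F N) h + L2_dist_sq M (F N) k)) \<longlongrightarrow> 2 * (0 + 0)) at_top"
    by (intro ennreal_tendsto_cmult tendsto_add h k) auto
  from tendsto_lowerbound[OF this, of "L2_dist_sq M h k"] le have "L2_dist_sq M h k \<le> 0"
    by simp
  then have "AE x in M. ennreal ((norm (h x - k x))\<^sup>2) = 0"
    unfolding L2_dist_sq_def by (subst (asm) le_zero_eq, subst (asm) nn_integral_0_iff_AE) auto
  then show ?thesis
    by eventually_elim simp
qed

text \<open>The Fourier integral is a witness for the choice in \<open>fourier_L2\<close>, and
  uniqueness of limits in the mean identifies the chosen function with it. The given
  \<open>f'\<close> is only almost everywhere equal to the Borel function \<open>f\<close>, so the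
  truncated integrals are first moved to \<open>f\<close>.\<close>

lemma fourier_L2_eq_fourier_integral:
  assumes f: "integrable lborel f" and f2: "integrable lborel (\<lambda>x. (norm (f x))\<^sup>2)"
    and eq: "AE x in lborel. f' x = f x"
  shows "fourier_L2 f' \<in> L2 lebesgue" "AE \<sigma> in lborel. fourier_L2 f' \<sigma> = fourier_integral f \<sigma>"
proof -
  have [measurable]: "f \<in> borel_measurable borel"
    using f by (auto dest: borel_measurable_integrable)
  define F where "F = (\<lambda>N. fourier_integral (\<lambda>x. if x \<in> ball 0 N then f' x else 0))"
  \<comment> \<open>The two forms have different uses: \<open>tail\<close> is what the mean-square
    inequality is applied to, while \<open>F\<close> exhibits \<open>F N\<close> as the transform of
    a Borel function and so gives its measurability.\<close>
  have tail: "F N \<sigma> - fourier_integral f \<sigma> = fourier_integral (\<lambda>x. indicat_real {x. N \<le> norm x} x *\<^sub>R - f x) \<sigma>" 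
    and F: "F N \<sigma> = fourier_integral (\<lambda>x. indicat_real {x. norm x < N} x *\<^sub>R f x) \<sigma>" for N \<sigma>
  proof -
    let ?e = "\<lambda>x. exp (- \<i> * complex_of_real (x \<bullet> \<sigma>))"
    have int: "integrable lborel (\<lambda>x. f x * ?e x)"
      by (rule Bochner_Integration.integrable_bound[OF f]) (auto simp: norm_mult)
    have int_N: "integrable lborel (\<lambda>x. (indicat_real {x. norm x < N} x *\<^sub>R f x) * ?e x)"
      by (rule Bochner_Integration.integrable_bound[OF f])
         (auto simp: norm_mult split: split_indicator)
    have "(\<integral>x. (if x \<in> ball 0 N then f' x else 0) * ?e x \<partial>lebesgue) =
        (\<integral>x. (indicat_real {x. norm x < N} x *\<^sub>R f x) * ?e x \<partial>lborel)"
    proof (rule integral_completion_AE)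
      show "AE x in lborel. (if x \<in> ball 0 N then f' x else 0) * ?e x =
          (indicat_real {x. norm x < N} x *\<^sub>R f x) * ?e x"
        using eq by eventually_elim auto
    qed measurable
    then show F: "F N \<sigma> = fourier_integral (\<lambda>x. indicat_real {x. norm x < N} x *\<^sub>R f x) \<sigma>"
      by (subst fourier_integral_borel) (auto simp: F_def fourier_integral_def)
    have "(\<integral>x. (indicat_real {x. norm x < N} x *\<^sub>R f x) * ?e x \<partial>lborel) - (\<integral>x. f x * ?e x \<partial>lborel) =
        (\<integral>x. (indicat_real {x. N \<le> norm x} x *\<^sub>R - f x) * ?e x \<partial>lborel)"
      unfolding Bochner_Integration.integral_diff[OF int_N int, symmetric]
      by (intro Bochner_Integration.integral_cong) (auto split: split_indicator)
    then show "F N \<sigma> - fourier_integral f \<sigma> =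
        fourier_integral (\<lambda>x. indicat_real {x. N \<le> norm x} x *\<^sub>R - f x) \<sigma>"
      unfolding F by (subst (1 2 3) fourier_integral_borel) (simp_all only: right_diff_distrib[symmetric], measurable)
  qed
  have F_meas: "F N \<in> borel_measurable lebesgue" for N
    unfolding F[abs_def] by (intro measurable_completion) (auto intro!: borel_measurable_fourier_integral)
  have L2: "fourier_integral f \<in> L2 lebesgue"
  proof -
    have [measurable]: "fourier_integral f \<in> borel_measurable borel"
      by (intro borel_measurable_fourier_integral) measurable
    have "(\<integral>\<^sup>+x. ennreal ((norm (f x))\<^sup>2) \<partial>lborel) < \<infinity>"
      using f2 by (simp add: integrable_iff_bounded)
    with fourier_integral_L2_le[OF f]
    have "(\<integral>\<^sup>+\<sigma>. ennreal ((norm (fourier_integral f \<sigma>))\<^sup>2) \<partial>lborel) < \<infinity>"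
      by (rule order.strict_trans1)
    then have "integrable lborel (\<lambda>\<sigma>. (norm (fourier_integral f \<sigma>))\<^sup>2)"
      by (simp add: integrable_iff_bounded)
    then show ?thesis
      by (simp add: L2_def integrable_completion measurable_completion)
  qed
  have lim: "((\<lambda>N. L2_dist_sq lebesgue (F N) (fourier_integral f)) \<longlongrightarrow> 0) at_top"
  proof -
    let ?t = "\<lambda>N x. indicat_real {x. N \<le> norm x} x * (norm (f x))\<^sup>2"
    have "((\<lambda>N. \<integral>x. ?t N x \<partial>lborel) \<longlongrightarrow> (\<integral>x. 0 \<partial>(lborel :: (real \<times> real) measure))) at_top"
    proof (rule integral_dominated_convergence_at_top)
      show "AE x in lborel. ((\<lambda>N. ?t N x) \<longlongrightarrow> 0) at_top"
      proof (intro AE_I2 tendsto_eventually)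
        fix x
        show "\<forall>\<^sub>F N in at_top. ?t N x = 0"
          using eventually_gt_at_top[of "norm x"] by eventually_elim simp
      qed
      show "\<forall>\<^sub>F N in at_top. AE x in lborel. norm (?t N x) \<le> (norm (f x))\<^sup>2"
        by (auto split: split_indicator)
    qed (use f2 in auto)
    then have tail_0: "((\<lambda>N. ennreal (\<integral>x. ?t N x \<partial>lborel)) \<longlongrightarrow> 0) at_top"
      using tendsto_ennrealI by fastforce
    have "L2_dist_sq lebesgue (F N) (fourier_integral f) \<le> ennreal (\<integral>x. ?t N x \<partial>lborel)" for N
    proof -
      have "integrable lborel (\<lambda>x. indicat_real {x. N \<le> norm x} x *\<^sub>R - f x)"
        by (rule Bochner_Integration.integrable_bound[OF f]) (auto split: split_indicator)
      from fourier_integral_L2_le[OF this]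
      have "L2_dist_sq lebesgue (F N) (fourier_integral f) \<le>
          (\<integral>\<^sup>+x. ennreal ((norm (indicat_real {x. N \<le> norm x} x *\<^sub>R - f x))\<^sup>2) \<partial>lborel)"
        unfolding L2_dist_sq_def tail by (simp add: nn_integral_completion)
      also have "\<dots> = (\<integral>\<^sup>+x. ennreal (?t N x) \<partial>lborel)"
        by (intro nn_integral_cong) (auto split: split_indicator)
      also have "\<dots> = ennreal (\<integral>x. ?t N x \<partial>lborel)"
        by (intro nn_integral_eq_integral Bochner_Integration.integrable_bound[OF f2])
           (auto split: split_indicator)
      finally show ?thesis .
    qed
    then show ?thesis
      by (intro tendsto_sandwich[OF _ _ tendsto_const tail_0] always_eventually allI) auto
  qed
  have *: "fourier_L2 f' \<in> L2 lebesgue \<and> ((\<lambda>N. L2_dist_sq lebesgue (F N) (fourier_L2 f')) \<longlongrightarrow> 0) at_top"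
    unfolding fourier_L2_def F_def
    by (rule someI[of _ "fourier_integral f"], rule conjI[OF L2]) (use lim in \<open>simp only: F_def\<close>)
  then show "fourier_L2 f' \<in> L2 lebesgue" ..
  have "AE \<sigma> in lebesgue. fourier_L2 f' \<sigma> = fourier_integral f \<sigma>"
    using * L2 lim by (intro L2_limit_unique[OF F_meas]) (auto simp: L2_def)
  then show "AE \<sigma> in lborel. fourier_L2 f' \<sigma> = fourier_integral f \<sigma>"
    by (simp add: AE_completion_iff)
qed

section \<open>Radial functions and their profiles\<close>

lemma AE_norm_square_plane:
  assumes "AE r in lborel. 0 < r \<longrightarrow> P r"
  shows "AE x :: real \<times> real in lborel. P ((norm x)\<^sup>2)"
proof -
  have "AE r in distr lborel borel (\<lambda>x::real \<times> real. (norm x)\<^sup>2). P r"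
    unfolding distr_norm_square_plane using assms by (subst AE_density) (auto split: split_indicator)
  then show ?thesis
    by (rule AE_distrD[rotated]) simp
qed

text \<open>The image measure has positive density on the half-line, so a null exceptional set in
  the plane forces a null one there. Reading the statement back through an image measure requires a
  Borel predicate, hence the passage from \<open>P\<close> to \<open>Q\<close>.\<close>

lemma AE_of_AE_norm_square_plane:
  assumes "Measurable.pred lebesgue (\<lambda>r. 0 < r \<longrightarrow> P r)"
    and P: "AE x :: real \<times> real in lborel. P ((norm x)\<^sup>2)"
  shows "AE r in lborel. 0 < r \<longrightarrow> P r"
proof -
  obtain Q where Q[measurable]: "Measurable.pred lborel Q" and eq: "AE r in lborel. (0 < r \<longrightarrow> P r) \<longleftrightarrow> Q r"
    using completion_ex_borel_pred[OF assms(1)] by blast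
  from eq have "AE r in lborel. 0 < r \<longrightarrow> (P r \<longrightarrow> Q r)"
    by eventually_elim auto
  with P have "AE x :: real \<times> real in lborel. Q ((norm x)\<^sup>2)"
    using AE_norm_square_plane by fastforce
  then have "AE r in distr lborel borel (\<lambda>x::real \<times> real. (norm x)\<^sup>2). Q r"
    by (subst AE_distr_iff) auto
  then have "AE r in lborel. 0 < ennreal pi * indicator {0<..} r \<longrightarrow> Q r"
    unfolding distr_norm_square_plane by (subst (asm) AE_density) auto
  with eq show ?thesis
    by eventually_elim (auto simp: ennreal_zero_less_mult_iff)
qed

lemma nn_integral_norm_square_plane:
  assumes [measurable]: "f \<in> borel_measurable borel"
  shows "(\<integral>\<^sup>+x. f ((norm x)\<^sup>2) \<partial>(lborel :: (real \<times> real) measure)) =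
    ennreal pi * (\<integral>\<^sup>+r. f r * indicator {0<..} r \<partial>lborel)"
proof -
  have "(\<integral>\<^sup>+x. f ((norm x)\<^sup>2) \<partial>(lborel :: (real \<times> real) measure)) =
      (\<integral>\<^sup>+r. f r \<partial>distr lborel borel (\<lambda>x::real \<times> real. (norm x)\<^sup>2))"
    by (subst nn_integral_distr) auto
  also have "\<dots> = ennreal pi * (\<integral>\<^sup>+r. f r * indicator {0<..} r \<partial>lborel)"
    unfolding distr_norm_square_plane
    by (subst nn_integral_density) (auto simp: mult_ac simp flip: nn_integral_cmult)
  finally show ?thesis .
qed

lemma AE_lebesgue_pos_iff: "(AE r in lebesgue_pos. P r) \<longleftrightarrow> (AE r in lborel. 0 < r \<longrightarrow> P r)"
  by (subst AE_restrict_space_iff) (auto simp: AE_completion_iff)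

lemma integrable_norm_square_plane_iff:
  fixes g :: "real \<Rightarrow> complex"
  assumes [measurable]: "g \<in> borel_measurable borel"
  shows "integrable lborel (\<lambda>x :: real \<times> real. (norm (g ((norm x)\<^sup>2)))\<^sup>2) \<longleftrightarrow> g \<in> L2 lebesgue_pos"
proof -
  have g: "g \<in> borel_measurable lebesgue_pos"
    by (intro measurable_restrict_space1 measurable_completion) simp
  have "integrable lborel (\<lambda>x :: real \<times> real. (norm (g ((norm x)\<^sup>2)))\<^sup>2) \<longleftrightarrow>
      ennreal pi * (\<integral>\<^sup>+r. ennreal ((norm (g r))\<^sup>2) * indicator {0<..} r \<partial>lborel) < \<infinity>"
    using nn_integral_norm_square_plane[of "\<lambda>r. ennreal ((norm (g r))\<^sup>2)"]
    by (simp add: integrable_iff_bounded)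
  also have "\<dots> \<longleftrightarrow> (\<integral>\<^sup>+r. ennreal ((norm (g r))\<^sup>2) * indicator {0<..} r \<partial>lborel) < \<infinity>"
    by (auto simp: ennreal_mult_less_top)
  also have "(\<integral>\<^sup>+r. ennreal ((norm (g r))\<^sup>2) * indicator {0<..} r \<partial>lborel) =
      (\<integral>\<^sup>+r. ennreal ((norm (g r))\<^sup>2) \<partial>lebesgue_pos)"
    by (subst nn_integral_restrict_space) (auto simp: nn_integral_completion)
  also have "\<dots> < \<infinity> \<longleftrightarrow> g \<in> L2 lebesgue_pos"
    using g by (auto simp: L2_def integrable_iff_bounded)
  finally show ?thesis .
qed

text \<open>\<open>E\<close> is a witness for the choice in \<open>Psi\<close>, its
  square-integrability being inherited from \<open>h\<close>. The chosen profile and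
  \<open>E\<close> have almost everywhere equal radial lifts, and this equality descends to the
  half-line.\<close>

lemma Psi_eq:
  assumes [measurable]: "E \<in> borel_measurable borel" and h: "h \<in> L2 lebesgue"
    and eq: "AE x in lborel. h x = E ((norm x)\<^sup>2)"
  shows "AE r in lebesgue_pos. Psi h r = E r"
proof -
  have "(\<integral>\<^sup>+x. ennreal ((norm (E ((norm x)\<^sup>2)))\<^sup>2) \<partial>(lborel :: (real \<times> real) measure)) =
      (\<integral>\<^sup>+x. ennreal ((norm (h x))\<^sup>2) \<partial>lebesgue)"
    unfolding nn_integral_completion by (intro nn_integral_cong_AE eventually_mono[OF eq]) simp
  also have "\<dots> < \<infinity>"
    using h by (simp add: L2_def integrable_iff_bounded)
  finally have "E \<in> L2 lebesgue_pos"
    by (subst integrable_norm_square_plane_iff[symmetric]) (auto simp: integrable_iff_bounded)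
  moreover have "AE x in lebesgue. Psi_inv E x = h x"
    using eq unfolding Psi_inv_def AE_completion_iff by eventually_elim simp
  ultimately have Psi: "Psi h \<in> L2 lebesgue_pos" "AE x in lebesgue. Psi_inv (Psi h) x = h x"
    unfolding Psi_def using someI[of "\<lambda>g. g \<in> L2 lebesgue_pos \<and> (AE x in lebesgue. Psi_inv g x = h x)" E]
    by auto
  \<comment> \<open>\<open>Psi h\<close> is known to be measurable only on the half-line. Off it the
    implication holds trivially, which makes the predicate measurable on the whole line.\<close>
  have meas: "Measurable.pred lebesgue (\<lambda>r. 0 < r \<longrightarrow> Psi h r = E r)"
  proof -
    have "Psi h \<in> borel_measurable lebesgue_pos" "E \<in> borel_measurable lebesgue_pos"
      using Psi by (auto simp: L2_def intro!: measurable_restrict_space1 measurable_completion)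
    then have "Measurable.pred lebesgue_pos (\<lambda>r. Psi h r = E r)"
      by measurable
    then have "Measurable.pred lebesgue (\<lambda>r. 0 < r \<and> Psi h r = E r)"
      by (subst (asm) pred_restrict_space) auto
    then have "Measurable.pred lebesgue (\<lambda>r. r \<le> 0 \<or> 0 < r \<and> Psi h r = E r)"
      by (rule pred_intros_logic(5)[rotated]) (intro measurable_completion, measurable)
    also have "(\<lambda>r. r \<le> 0 \<or> 0 < r \<and> Psi h r = E r) = (\<lambda>r. 0 < r \<longrightarrow> Psi h r = E r)"
      by (auto simp: fun_eq_iff)
    finally show ?thesis .
  qed
  have "AE x :: real \<times> real in lborel. Psi h ((norm x)\<^sup>2) = E ((norm x)\<^sup>2)"
    using Psi(2) eq unfolding Psi_inv_def AE_completion_iff by eventually_elim simp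
  from AE_of_AE_norm_square_plane[OF meas this] show ?thesis
    by (simp add: AE_lebesgue_pos_iff)
qed

text \<open>Removes both choices at once: when the lift of a Borel representative is integrable,
  \<open>Phi\<close> is read off from an absolutely convergent Fourier integral that is radial with
  profile \<open>E\<close>.\<close>

lemma Phi_eq:
  fixes g g0 E :: "real \<Rightarrow> complex"
  assumes g: "g \<in> L2 lebesgue_pos" and [measurable]: "g0 \<in> borel_measurable borel"
    and eq: "AE r in lebesgue_pos. g r = g0 r"
    and int: "integrable lborel (Psi_inv g0)"
    and E: "\<And>\<sigma>. fourier_integral (Psi_inv g0) \<sigma> = E ((norm \<sigma>)\<^sup>2)"
    and E_meas: "E \<in> borel_measurable borel"
  shows "AE r in lebesgue_pos. Phi g r = E r"
proof -
  have g0: "g0 \<in> borel_measurable lebesgue_pos"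
    by (intro measurable_restrict_space1 measurable_completion) simp
  have [measurable]: "g \<in> borel_measurable lebesgue_pos"
    using g by (simp add: L2_def)
  have "integrable lebesgue_pos (\<lambda>r. (norm (g r))\<^sup>2) \<longleftrightarrow> integrable lebesgue_pos (\<lambda>r. (norm (g0 r))\<^sup>2)"
    using eq g0 by (intro integrable_cong_AE) (auto elim: eventually_mono)
  with g g0 have "g0 \<in> L2 lebesgue_pos"
    by (simp add: L2_def)
  then have int2: "integrable lborel (\<lambda>x. (norm (Psi_inv g0 x))\<^sup>2)"
    unfolding Psi_inv_def by (subst integrable_norm_square_plane_iff) auto
  have "AE x in lborel. Psi_inv g x = Psi_inv g0 x"
    using AE_norm_square_plane[of "\<lambda>r. g r = g0 r"] eq by (simp add: AE_lebesgue_pos_iff Psi_inv_def)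
  note fourier_L2_eq_fourier_integral[OF int int2 this]
  then show ?thesis
    unfolding Phi_def E by (intro Psi_eq[OF E_meas])
qed

section \<open>The Laplace integral of a bounded control\<close>

text \<open>Used only for bounded \<open>v\<close> vanishing outside \<open>{0<..<T}\<close>: it is
  then a finite Laplace transform, convergent for every complex \<open>z\<close>.\<close>

definition laplace_integral :: "(real \<Rightarrow> complex) \<Rightarrow> complex \<Rightarrow> complex"
  where "laplace_integral v z = (\<integral>\<xi>. exp (- of_real \<xi> * z) * v \<xi> \<partial>lborel)"

text \<open>
  The control is used after the reflection $v(\xi)=u(T-\xi)$, extended by zero and modified on a
  null set so as to be Borel measurable and bounded everywhere.
\<close>

definition control_bound :: "real \<Rightarrow> real \<Rightarrow> (real \<Rightarrow> complex) \<Rightarrow> bool"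
  where "control_bound T L v \<longleftrightarrow>
    v \<in> borel_measurable borel \<and> (\<forall>\<xi>. norm (v \<xi>) \<le> L * indicator {0<..<T} \<xi>)"

lemma control_boundD:
  assumes "control_bound T L v"
  shows "v \<in> borel_measurable borel" "norm (v \<xi>) \<le> L * indicator {0<..<T} \<xi>"
    and "\<not> (0 < \<xi> \<and> \<xi> < T) \<Longrightarrow> v \<xi> = 0" "0 \<le> L * indicator {0<..<T} \<xi>"
proof -
  have le: "norm (v \<xi>) \<le> L * indicator {0<..<T} \<xi>" for \<xi>
    using assms by (auto simp: control_bound_def)
  then show "norm (v \<xi>) \<le> L * indicator {0<..<T} \<xi>" .
  show "v \<in> borel_measurable borel"
    using assms by (auto simp: control_bound_def)
  show "0 \<le> L * indicator {0<..<T} \<xi>"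
    using le[of \<xi>] norm_ge_zero order.trans by blast
  show "v \<xi> = 0" if "\<not> (0 < \<xi> \<and> \<xi> < T)"
    using le[of \<xi>] that by (auto split: split_indicator_asm)
qed

lemma integrable_control:
  assumes v: "control_bound T L v"
  shows "integrable lborel v"
proof (rule Bochner_Integration.integrable_bound)
  show "integrable lborel (\<lambda>\<xi>. L * indicator {0<..<T} \<xi> :: real)"
    by (cases "0 \<le> T") auto
qed (use control_boundD[OF v] in auto)

text \<open>The origin of the quotient in the final estimate, with \<open>c = norm z\<close>; the
  value \<open>T\<close> at \<open>c = 0\<close> is the limit of the quotient.\<close>

lemma integral_exp_indicator:
  fixes T c :: real
  assumes "0 < T" "0 \<le> c"
  shows "has_bochner_integral lborel (\<lambda>\<xi>. exp (\<xi> * c) * indicator {0..T} \<xi>)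
    (if c = 0 then T else (exp (T * c) - 1) / c)"
proof (cases "c = 0")
  case True
  then show ?thesis
    using has_bochner_integral_FTC_Icc_real[of 0 T "\<lambda>x. x" "\<lambda>_. 1"] assms by simp
next
  case False
  have "has_bochner_integral lborel (\<lambda>\<xi>. exp (\<xi> * c) * indicator {0..T} \<xi>)
      (exp (T * c) / c - exp (0 * c) / c)"
    using False assms
    by (intro has_bochner_integral_FTC_Icc_real) (auto intro!: derivative_eq_intros)
  with False show ?thesis
    by (simp add: diff_divide_distrib)
qed

text \<open>The modulus of \<open>exp (- of_real \<xi> * z)\<close> is at most
  \<open>exp (\<xi> * norm z)\<close> for positive \<xi>, with equality for negative real
  \<open>z\<close>, and the control is at most \<open>L\<close>.\<close>

lemma norm_laplace_integral_le:
  assumes "0 < T" and v: "control_bound T L v"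
  shows "norm (laplace_integral v z) \<le> L * (if z = 0 then T else (exp (T * norm z) - 1) / norm z)"
proof -
  have [measurable]: "v \<in> borel_measurable borel"
    by (rule control_boundD[OF v])
  have "norm (laplace_integral v z) \<le> (\<integral>\<xi>. norm (exp (- of_real \<xi> * z) * v \<xi>) \<partial>lborel)"
    unfolding laplace_integral_def by (rule integral_norm_bound)
  also have "\<dots> \<le> (\<integral>\<xi>. L * (exp (\<xi> * norm z) * indicator {0..T} \<xi>) \<partial>lborel)"
  proof (rule integral_mono)
    show int: "integrable lborel (\<lambda>\<xi>. L * (exp (\<xi> * norm z) * indicator {0..T} \<xi>))"
      using integral_exp_indicator[OF \<open>0 < T\<close>, of "norm z"] by (simp add: has_bochner_integral_iff)
    show le: "norm (exp (- of_real \<xi> * z) * v \<xi>) \<le> L * (exp (\<xi> * norm z) * indicator {0..T} \<xi>)" for \<xi>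
    proof (cases "0 < \<xi> \<and> \<xi> < T")
      case True
      have "norm (exp (- of_real \<xi> * z)) \<le> exp (norm (- of_real \<xi> * z))"
        by (rule norm_exp)
      also have "\<dots> = exp (\<xi> * norm z)"
        using True by (simp add: norm_mult)
      finally have "norm (exp (- of_real \<xi> * z)) * norm (v \<xi>) \<le> exp (\<xi> * norm z) * L"
        using True control_boundD(2)[OF v, of \<xi>] by (intro mult_mono) auto
      then show ?thesis
        using True by (simp add: norm_mult mult.commute)
    next
      case False
      \<comment> \<open>The midpoint is just some point of the interval, where the indicator is 1
        and the bound reveals the sign of \<open>L\<close>.\<close>
      have "0 \<le> L"
        using control_boundD(4)[OF v, of "T / 2"] \<open>0 < T\<close> by (simp add: indicator_def)
      with False show ?thesis
        using control_boundD(3)[OF v, of \<xi>] by simp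
    qed
    show "integrable lborel (\<lambda>\<xi>. norm (exp (- of_real \<xi> * z) * v \<xi>))"
      by (rule Bochner_Integration.integrable_bound[OF int])
         (measurable, use le order.trans[OF le abs_ge_self] in simp)
  qed
  also have "\<dots> = L * (if z = 0 then T else (exp (T * norm z) - 1) / norm z)"
    using integral_exp_indicator[OF \<open>0 < T\<close>, of "norm z"]
    by (auto simp: has_bochner_integral_iff split: if_splits)
  finally show ?thesis .
qed

text \<open>The exponential series is integrated term by term. On the support of \<open>v\<close>
  its terms are dominated by those of the series of \<open>exp (T * norm z)\<close>, so one power
  series represents the function in the whole plane; its coefficients \<open>a n\<close> are signed
  moments of \<open>v\<close> over factorials.\<close>

lemma laplace_integral_holomorphic:
  assumes "0 < T" and v: "control_bound T L v"
  shows "laplace_integral v holomorphic_on UNIV"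
proof -
  define a where "a n = (\<integral>\<xi>. (- of_real \<xi>) ^ n / fact n * v \<xi> \<partial>lborel)" for n :: nat
  have [measurable]: "v \<in> borel_measurable borel"
    by (rule control_boundD[OF v])
  have "(\<lambda>n. a n * (z - 0) ^ n) sums laplace_integral v z" for z
  proof -
    let ?f = "\<lambda>n \<xi>. (- of_real \<xi> * z) ^ n /\<^sub>R fact n * v \<xi>"
    have le: "norm (?f n \<xi>) \<le> (T * norm z) ^ n /\<^sub>R fact n * norm (v \<xi>)" for n \<xi>
    proof (cases "0 < \<xi> \<and> \<xi> < T")
      case True
      then have "(\<xi> * norm z) ^ n \<le> (T * norm z) ^ n"
        by (intro power_mono mult_right_mono) auto
      with True show ?thesis
        by (auto simp: norm_mult norm_power divide_inverse intro!: mult_right_mono)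
    qed (use control_boundD(3)[OF v, of \<xi>] in simp)
    have int_v: "integrable lborel (\<lambda>\<xi>. (T * norm z) ^ n /\<^sub>R fact n * norm (v \<xi>))" for n
      using integrable_control[OF v] by (intro integrable_mult_right integrable_norm)
    have int: "integrable lborel (?f n)" for n
      by (rule Bochner_Integration.integrable_bound[OF int_v[of n]])
         (measurable, use le order.trans[OF le abs_ge_self] in auto)
    have "(\<lambda>n. integral\<^sup>L lborel (?f n)) sums (\<integral>\<xi>. (\<Sum>n. ?f n \<xi>) \<partial>lborel)"
    proof (rule sums_integral[OF int])
      have sum_exp: "summable (\<lambda>n. (T * norm z) ^ n /\<^sub>R fact n * c)" for c
        by (intro summable_mult2 summable_exp_generic)
      show "AE \<xi> in lborel. summable (\<lambda>n. norm (?f n \<xi>))"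
      proof (rule AE_I2)
        fix \<xi>
        show "summable (\<lambda>n. norm (?f n \<xi>))"
          by (rule summable_comparison_test'[OF sum_exp, of 0 _ "norm (v \<xi>)"]) (use le in simp)
      qed
      show "summable (\<lambda>n. \<integral>\<xi>. norm (?f n \<xi>) \<partial>lborel)"
      proof (rule summable_comparison_test'[OF sum_exp])
        fix n :: nat
        have "(\<integral>\<xi>. norm (?f n \<xi>) \<partial>lborel) \<le> (\<integral>\<xi>. (T * norm z) ^ n /\<^sub>R fact n * norm (v \<xi>) \<partial>lborel)"
          by (rule integral_mono[OF integrable_norm[OF int] int_v le])
        also have "\<dots> = (T * norm z) ^ n /\<^sub>R fact n * (\<integral>\<xi>. norm (v \<xi>) \<partial>lborel)"
          by (rule integral_mult_right_zero)
        finally show "norm (\<integral>\<xi>. norm (?f n \<xi>) \<partial>lborel) \<le>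
            (T * norm z) ^ n /\<^sub>R fact n * (\<integral>\<xi>. norm (v \<xi>) \<partial>lborel)"
          by (subst real_norm_def, subst abs_of_nonneg) (auto intro: integral_nonneg_AE)
      qed
    qed
    also have "(\<lambda>n. integral\<^sup>L lborel (?f n)) = (\<lambda>n. a n * (z - 0) ^ n)"
    proof
      fix n
      have "integral\<^sup>L lborel (?f n) = (\<integral>\<xi>. ((- of_real \<xi>) ^ n / fact n * v \<xi>) * z ^ n \<partial>lborel)"
        by (intro Bochner_Integration.integral_cong refl)
           (simp only: power_mult_distrib scaleR_conv_of_real divide_inverse of_real_inverse of_real_fact mult_ac)
      then show "integral\<^sup>L lborel (?f n) = a n * (z - 0) ^ n"
        by (simp add: a_def)
    qed
    also have "(\<integral>\<xi>. (\<Sum>n. ?f n \<xi>) \<partial>lborel) = laplace_integral v z"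
      unfolding laplace_integral_def exp_def
      by (intro Bochner_Integration.integral_cong refl suminf_mult2[symmetric] summable_exp_generic)
    finally show ?thesis .
  qed
  then have "laplace_integral v holomorphic_on ball 0 r" for r
    by (intro power_series_holomorphic[where a = a]) auto
  then have "laplace_integral v field_differentiable at z" for z
    using holomorphic_on_imp_differentiable_at[of _ "ball 0 (norm z + 1)" z] by auto
  then show ?thesis
    by (simp add: holomorphic_on_def field_differentiable_at_within)
qed

text \<open>The elementary bound \<open>exp t - 1 \<le> t * exp t\<close> with
  \<open>t = T * norm z\<close> removes the denominator, so \<open>C * T\<close> serves as the
  constant for every \<epsilon>.\<close>

lemma order_le_1_type_leI:
  assumes "0 < T" "0 \<le> C"
    and le: "\<And>z. norm (E z) \<le> C * (if z = 0 then T else (exp (T * norm z) - 1) / norm z)"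
  shows "order_le_1_type_le E T"
proof -
  have "norm (E z) \<le> (C * T) * exp ((T + \<epsilon>) * norm z)" if "\<epsilon> > 0" for \<epsilon> z
  proof -
    have "(if z = 0 then T else (exp (T * norm z) - 1) / norm z) \<le> T * exp (T * norm z)"
    proof (cases "z = 0")
      case False
      have "1 - T * norm z \<le> exp (- (T * norm z))"
        using exp_ge_add_one_self[of "- (T * norm z)"] by simp
      then have "(1 - T * norm z) * exp (T * norm z) \<le> exp (- (T * norm z)) * exp (T * norm z)"
        by (rule mult_right_mono) simp
      also have "\<dots> = 1"
        by (simp add: exp_minus)
      finally show ?thesis
        using False by (simp add: field_simps)
    qed simp
    also have "\<dots> \<le> T * exp ((T + \<epsilon>) * norm z)"
      using assms that by (intro mult_left_mono) (auto intro: mult_right_mono)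
    finally have "C * (if z = 0 then T else (exp (T * norm z) - 1) / norm z) \<le>
        C * (T * exp ((T + \<epsilon>) * norm z))"
      using \<open>0 \<le> C\<close> by (rule mult_left_mono)
    with le[of z] show ?thesis
      by (simp add: mult.assoc)
  qed
  then show ?thesis
    unfolding order_le_1_type_le_def by blast
qed

section \<open>The transform of a superposition of heat kernels\<close>

text \<open>At the origin of the plane the kernel is \<open>1 / (2 * \<xi>)\<close>, which is not
  integrable near 0. Tonelli's theorem is therefore used with the planar integral inside, where the
  singularity disappears; what remains is \<open>2 * pi\<close> times the integral of
  \<open>norm (v \<xi>)\<close>.\<close>

lemma integrable_heat_kernel_control:
  assumes v: "control_bound T L v"
  shows "integrable (lborel \<Otimes>\<^sub>M lborel) (\<lambda>(x :: real \<times> real, \<xi>).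
    of_real (1 / (2 * \<xi>) * exp (- (norm x)\<^sup>2 / (4 * \<xi>))) * v \<xi>)" (is "integrable _ ?H")
  unfolding lborel_prod
proof (rule integrableI_bounded)
  have [measurable]: "v \<in> borel_measurable borel"
    by (rule control_boundD[OF v])
  have "?H \<in> borel_measurable (borel \<Otimes>\<^sub>M borel)"
    by measurable
  then have [measurable]: "?H \<in> borel_measurable borel"
    by (simp only: borel_prod)
  then show "?H \<in> borel_measurable lborel"
    by simp
  have 1: "(\<integral>\<^sup>+x. ennreal (norm (?H (x, \<xi>))) \<partial>lborel) = ennreal (2 * pi * norm (v \<xi>))" for \<xi>
  proof (cases "0 < \<xi> \<and> \<xi> < T")
    case True
    then have gauss: "(\<integral>\<^sup>+x. ennreal (exp (- (1 / (4 * \<xi>) * (norm (x - 0))\<^sup>2)))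
        \<partial>(lborel :: (real \<times> real) measure)) = ennreal (pi / (1 / (4 * \<xi>)))"
      by (intro nn_integral_gaussian_plane) simp
    have "(\<integral>\<^sup>+x. ennreal (norm (?H (x, \<xi>))) \<partial>lborel) =
        (\<integral>\<^sup>+x. ennreal (norm (v \<xi>) / (2 * \<xi>)) * ennreal (exp (- (1 / (4 * \<xi>) * (norm (x - 0))\<^sup>2)))
          \<partial>(lborel :: (real \<times> real) measure))"
      using True by (intro nn_integral_cong) (simp add: norm_mult norm_divide abs_mult flip: ennreal_mult)
    also have "\<dots> = ennreal (norm (v \<xi>) / (2 * \<xi>)) * ennreal (pi / (1 / (4 * \<xi>)))"
      unfolding gauss[symmetric] by (rule nn_integral_cmult) measurable
    also have "\<dots> = ennreal (2 * pi * norm (v \<xi>))"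
      using True by (subst ennreal_mult[symmetric]) (auto simp: field_simps)
    finally show ?thesis .
  \<comment> \<open>For negative \<xi> the exponential grows with \<open>x\<close>; the vanishing of
    \<open>v\<close> there keeps the formula true.\<close>
  qed (use control_boundD(3)[OF v, of \<xi>] in simp)
  have "(\<integral>\<^sup>+x. ennreal (norm (?H x)) \<partial>lborel) = (\<integral>\<^sup>+\<xi>. ennreal (2 * pi * norm (v \<xi>)) \<partial>lborel)"
    by (subst nn_integral_lborel_pair(2)) (simp, simp only: 1)
  also have "\<dots> < \<infinity>"
    using integrable_mult_right[OF integrable_norm[OF integrable_control[OF v]], of "2 * pi"]
    by (subst nn_integral_eq_integral) auto
  finally show "(\<integral>\<^sup>+x. ennreal (norm (?H x)) \<partial>lborel) < \<infinity>" .
qed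

text \<open>The integral of \<open>reachable_set\<close> for a control already reflected and
  extended by zero. For \<open>r \<le> 0\<close> it may fail to converge and then has the default
  value 0; \<open>Psi_inv\<close> evaluates it only at nonnegative \<open>r\<close>, and at
  \<open>r = 0\<close> only in the origin.\<close>

definition heat_integral :: "(real \<Rightarrow> complex) \<Rightarrow> real \<Rightarrow> complex"
  where "heat_integral v r = - (1 / of_real pi) *
    (\<integral>\<xi>. of_real (1 / (2 * \<xi>) * exp (- r / (4 * \<xi>))) * v \<xi> \<partial>lborel)"

lemma borel_measurable_heat_integral:
  assumes [measurable]: "v \<in> borel_measurable borel"
  shows "heat_integral v \<in> borel_measurable borel"
  unfolding heat_integral_def[abs_def] by measurable

lemma integrable_Psi_inv_heat_integral:
  assumes v: "control_bound T L v"
  shows "integrable lborel (Psi_inv (heat_integral v))"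
  using lborel_pair.integrable_fst'[OF integrable_heat_kernel_control[OF v]]
  by (auto simp: Psi_inv_def[abs_def] heat_integral_def)

text \<open>The Gaussian with parameter \<open>1 / (4 * \<xi>)\<close> contributes the constant
  \<open>4 * pi * \<xi>\<close>, which the prefactor \<open>1 / (2 * \<xi>)\<close> reduces to
  \<open>2 * pi\<close> and the normalisation of the transform cancels. Hence \<sigma> enters only
  through its norm, and the kernel in \<xi> is a pure exponential.\<close>

lemma fourier_integral_heat_integral:
  assumes v: "control_bound T L v"
  shows "fourier_integral (Psi_inv (heat_integral v)) \<sigma> =
    - (1 / of_real pi) * laplace_integral v (of_real ((norm \<sigma>)\<^sup>2))"
proof -
  let ?H = "\<lambda>(x :: real \<times> real) \<xi>. of_real (1 / (2 * \<xi>) * exp (- (norm x)\<^sup>2 / (4 * \<xi>))) * v \<xi>"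
  let ?e = "\<lambda>x. exp (- \<i> * complex_of_real (x \<bullet> \<sigma>))"
  have [measurable]: "v \<in> borel_measurable borel"
    by (rule control_boundD[OF v])
  have "integrable (lborel \<Otimes>\<^sub>M lborel) (\<lambda>(x, \<xi>). ?H x \<xi> * ?e x)"
  proof (rule Bochner_Integration.integrable_bound[OF integrable_heat_kernel_control[OF v]])
    show "(\<lambda>(x, \<xi>). ?H x \<xi> * ?e x) \<in> borel_measurable (lborel \<Otimes>\<^sub>M lborel)"
      by measurable
  qed (auto simp: norm_mult norm_divide)
  from lborel_pair.Fubini_integral[OF this]
  have Fubini: "(\<integral>x. (\<integral>\<xi>. ?H x \<xi> * ?e x \<partial>lborel) \<partial>lborel) = (\<integral>\<xi>. (\<integral>x. ?H x \<xi> * ?e x \<partial>lborel) \<partial>lborel)"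
    by simp
  have inner: "(\<integral>x. ?H x \<xi> * ?e x \<partial>lborel) =
      2 * of_real pi * (exp (- of_real \<xi> * of_real ((norm \<sigma>)\<^sup>2)) * v \<xi>)" for \<xi>
  proof (cases "0 < \<xi> \<and> \<xi> < T")
    case True
    have "(\<integral>x. ?H x \<xi> * ?e x \<partial>lborel) =
        (\<integral>x. of_real (1 / (2 * \<xi>)) * v \<xi> * (of_real (exp (- (1 / (4 * \<xi>) * (norm x)\<^sup>2))) * ?e x) \<partial>lborel)"
      by (intro Bochner_Integration.integral_cong refl) (simp add: mult_ac)
    also have "\<dots> = of_real (1 / (2 * \<xi>)) * v \<xi> *
        of_real (pi / (1 / (4 * \<xi>)) * exp (- ((norm \<sigma>)\<^sup>2 / (4 * (1 / (4 * \<xi>))))))"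
      using gaussian_fourier_plane[of "1 / (4 * \<xi>)" \<sigma>] True
      by (simp only: integral_mult_right_zero has_bochner_integral_iff) simp
    also have "pi / (1 / (4 * \<xi>)) * exp (- ((norm \<sigma>)\<^sup>2 / (4 * (1 / (4 * \<xi>))))) =
        4 * \<xi> * pi * exp (- \<xi> * (norm \<sigma>)\<^sup>2)"
      using True by (simp add: mult_ac)
    finally show ?thesis
      using True by (simp add: exp_of_real[symmetric])
  qed (use control_boundD(3)[OF v, of \<xi>] in simp)
  \<comment> \<open>Constant factors pass through the Bochner integral even where it takes its
    default value, so the identity holds for every \<open>x\<close>, the origin included.\<close>
  have kernel: "Psi_inv (heat_integral v) x * ?e x = - (1 / of_real pi) * (\<integral>\<xi>. ?H x \<xi> * ?e x \<partial>lborel)" for x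
    by (simp only: integral_mult_left_zero Psi_inv_def heat_integral_def mult.assoc[of "- (1 / of_real pi)"])
  have "fourier_integral (Psi_inv (heat_integral v)) \<sigma> =
      1 / (2 * of_real pi) * (\<integral>x. - (1 / of_real pi) * (\<integral>\<xi>. ?H x \<xi> * ?e x \<partial>lborel) \<partial>lborel)"
    using borel_measurable_integrable[OF integrable_Psi_inv_heat_integral[OF v]]
    by (subst fourier_integral_borel) (simp_all only: kernel, simp)
  also have "\<dots> = 1 / (2 * of_real pi) * (- (1 / of_real pi) *
      (2 * of_real pi * laplace_integral v (of_real ((norm \<sigma>)\<^sup>2))))"
    unfolding integral_mult_right_zero Fubini inner laplace_integral_def ..
  also have "\<dots> = - (1 / of_real pi) * laplace_integral v (of_real ((norm \<sigma>)\<^sup>2))"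
    by simp
  finally show ?thesis .
qed

section \<open>Reflection and regularisation of the control\<close>

text \<open>\<open>P\<close> is arbitrary, so the affine substitution is applied instead to
  membership in a Borel null set containing its exceptions.\<close>

lemma AE_lborel_reflect:
  fixes c :: real
  assumes "AE t in lborel. P t"
  shows "AE t in lborel. P (c - t)"
proof -
  obtain N where N: "{t. \<not> P t} \<subseteq> N" "N \<in> null_sets lborel"
    using assms unfolding eventually_ae_filter by auto
  then have "AE t in lborel. t \<notin> N"
    by (intro AE_not_in)
  then have "AE t in lborel. c + (- 1) * t \<notin> N"
    using N(2) by (intro AE_borel_affine) auto
  then show ?thesis
    by eventually_elim (use N(1) in auto)
qed

text \<open>A Borel representative of the control extended by zero is cut to 0 where its modulus
  exceeds \<open>L\<close>. By the essential bound this changes it only on a null set within the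
  interval, and \<open>0 \<le> L\<close> keeps the bound true where the value has become 0.\<close>

lemma ex_control_bound:
  assumes u: "u \<in> Linf (lebesgue_on {0<..<T})"
    and L: "Linf_norm (lebesgue_on {0<..<T}) u \<le> ereal L"
    and "0 \<le> L"
  shows "\<exists>v. control_bound T L v \<and> (AE \<xi> in lborel. 0 < \<xi> \<and> \<xi> < T \<longrightarrow> v \<xi> = u (T - \<xi>))"
proof -
  have "(\<lambda>x. indicator {0<..<T} x *\<^sub>R u x) \<in> borel_measurable lebesgue"
    using u by (auto simp: Linf_def borel_measurable_restrict_space_iff)
  from completion_ex_borel_measurable_complex[OF this]
  obtain u' where [measurable]: "u' \<in> borel_measurable borel"
    and u': "AE x in lborel. indicator {0<..<T} x *\<^sub>R u x = u' x"
    by auto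
  have "AE x in lebesgue_on {0<..<T}. ereal (norm (u x)) \<le> ereal L"
    using esssup_AE[of "\<lambda>x. ereal (norm (u x))" "lebesgue_on {0<..<T}"]
  proof eventually_elim
    case (elim x)
    also have "esssup (lebesgue_on {0<..<T}) (\<lambda>x. ereal (norm (u x))) \<le> ereal L"
      using L by (simp add: Linf_norm_def)
    finally show ?case .
  qed
  then have le: "AE x in lborel. 0 < x \<and> x < T \<longrightarrow> norm (u x) \<le> L"
    by (subst (asm) AE_restrict_space_iff) (auto simp: AE_completion_iff)
  define w where "w x = (if 0 < x \<and> x < T \<and> norm (u' x) \<le> L then u' x else 0)" for x
  have [measurable]: "w \<in> borel_measurable borel"
    unfolding w_def[abs_def] by measurable
  have "AE x in lborel. 0 < x \<and> x < T \<longrightarrow> w x = u x"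
    using u' le by eventually_elim (auto simp: w_def)
  then have "AE \<xi> in lborel. 0 < T - \<xi> \<and> T - \<xi> < T \<longrightarrow> w (T - \<xi>) = u (T - \<xi>)"
    by (rule AE_lborel_reflect)
  then have "AE \<xi> in lborel. 0 < \<xi> \<and> \<xi> < T \<longrightarrow> w (T - \<xi>) = u (T - \<xi>)"
    by eventually_elim auto
  moreover have "control_bound T L (\<lambda>\<xi>. w (T - \<xi>))"
    using \<open>0 \<le> L\<close> by (auto simp: control_bound_def w_def split: split_indicator)
  ultimately show ?thesis
    by blast
qed

theorem theorem4p2:
  fixes T L :: real and g G :: "real \<Rightarrow> complex"
  assumes "T > 0" and "L > 0"
    and "g \<in> reachable_set T L"
    and "AE \<rho> in lebesgue_pos. G \<rho> = Phi g \<rho>"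
  shows "\<exists>Ge :: complex \<Rightarrow> complex.
    Ge holomorphic_on UNIV \<and>
    order_le_1_type_le Ge T \<and>
    (AE \<rho> in lebesgue_pos. Ge (of_real \<rho>) = G \<rho>) \<and>
    (\<forall>z. norm (Ge z) \<le>
      L / pi * (if z = 0 then T else (exp (T * norm z) - 1) / norm z))"
proof -
  obtain u where g: "g \<in> L2 lebesgue_pos"
    and u: "u \<in> Linf (lebesgue_on {0<..<T})" "Linf_norm (lebesgue_on {0<..<T}) u \<le> ereal L"
    and g_eq: "AE r in lebesgue_pos. g r = - (1 / of_real pi) *
      (\<integral>\<xi>. of_real (1 / (2 * \<xi>) * exp (- r / (4 * \<xi>))) * u (T - \<xi>) \<partial>lebesgue_on {0<..<T})"
    using assms(3) unfolding reachable_set_def by blast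
  obtain v where v: "control_bound T L v"
    and uv: "AE \<xi> in lborel. 0 < \<xi> \<and> \<xi> < T \<longrightarrow> v \<xi> = u (T - \<xi>)"
    using ex_control_bound[OF u] \<open>L > 0\<close> by auto
  have [measurable]: "v \<in> borel_measurable borel"
    by (rule control_boundD[OF v])
  \<comment> \<open>For fixed \<open>r\<close> the integrands agree for almost every \<xi>, so the
    equality holds for every \<open>r\<close>, even where the integrals have their default
    value.\<close>
  have "(\<integral>\<xi>. of_real (1 / (2 * \<xi>) * exp (- r / (4 * \<xi>))) * u (T - \<xi>) \<partial>lebesgue_on {0<..<T}) =
      (\<integral>\<xi>. of_real (1 / (2 * \<xi>) * exp (- r / (4 * \<xi>))) * v \<xi> \<partial>lborel)" for r
  proof -
    have "(\<integral>\<xi>. of_real (1 / (2 * \<xi>) * exp (- r / (4 * \<xi>))) * u (T - \<xi>) \<partial>lebesgue_on {0<..<T}) =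
        (\<integral>\<xi>. indicator {0<..<T} \<xi> *\<^sub>R (of_real (1 / (2 * \<xi>) * exp (- r / (4 * \<xi>))) * u (T - \<xi>)) \<partial>lebesgue)"
      by (rule integral_restrict_space) simp
    also have "\<dots> = (\<integral>\<xi>. of_real (1 / (2 * \<xi>) * exp (- r / (4 * \<xi>))) * v \<xi> \<partial>lborel)"
    proof (rule integral_completion_AE)
      show "AE \<xi> in lborel. indicator {0<..<T} \<xi> *\<^sub>R
          (of_real (1 / (2 * \<xi>) * exp (- r / (4 * \<xi>))) * u (T - \<xi>)) =
          of_real (1 / (2 * \<xi>) * exp (- r / (4 * \<xi>))) * v \<xi>"
        using uv by eventually_elim (use control_boundD(3)[OF v] in \<open>auto split: split_indicator\<close>)
    qed measurable
    finally show ?thesis .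
  qed
  with g_eq have eq: "AE r in lebesgue_pos. g r = heat_integral v r"
    by (simp add: heat_integral_def)
  define Ge where "Ge z = - (1 / of_real pi) * laplace_integral v z" for z
  have holo: "Ge holomorphic_on UNIV"
    unfolding Ge_def[abs_def] by (intro holomorphic_intros laplace_integral_holomorphic[OF \<open>T > 0\<close> v])
  have bound: "norm (Ge z) \<le> L / pi * (if z = 0 then T else (exp (T * norm z) - 1) / norm z)" for z
  proof -
    have "norm (Ge z) = norm (laplace_integral v z) / pi"
      by (simp add: Ge_def norm_mult norm_divide)
    also have "\<dots> \<le> L * (if z = 0 then T else (exp (T * norm z) - 1) / norm z) / pi"
      by (intro divide_right_mono norm_laplace_integral_le[OF \<open>T > 0\<close> v]) simp
    finally show ?thesis
      by simp
  qed
  have "AE \<rho> in lebesgue_pos. Phi g \<rho> = Ge (of_real \<rho>)"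
  proof (rule Phi_eq[OF g _ eq])
    show "heat_integral v \<in> borel_measurable borel"
      by (rule borel_measurable_heat_integral) measurable
    show "integrable lborel (Psi_inv (heat_integral v))"
      by (rule integrable_Psi_inv_heat_integral[OF v])
    show "fourier_integral (Psi_inv (heat_integral v)) \<sigma> = Ge (of_real ((norm \<sigma>)\<^sup>2))" for \<sigma>
      unfolding Ge_def by (rule fourier_integral_heat_integral[OF v])
    show "(\<lambda>\<rho>. Ge (of_real \<rho>)) \<in> borel_measurable borel"
      by (intro borel_measurable_continuous_onI continuous_on_compose2[OF holomorphic_on_imp_continuous_on[OF holo]]
          continuous_intros) auto
  qed
  with assms(4) have "AE \<rho> in lebesgue_pos. Ge (of_real \<rho>) = G \<rho>"
    by eventually_elim simp
  with holo bound order_le_1_type_leI[OF \<open>T > 0\<close> _ bound] \<open>L > 0\<close> show ?thesis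
    by (intro exI[of _ Ge]) auto
qed

end
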